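(* Let $1\leqslant p<2$ and let $\{X_{n},\,n\geqslant 1\}$ be a sequence of random variables stochastically dominated by a random variable $X$ with $\mathbb{E}\lvert X\rvert^{p}<\infty$. Suppose there is a constant $C>0$ such that $$\left\lvert\sum_{m\leqslant i<j\leqslant n}\mathrm{Cov}\big(\varphi(X_{i}),\varphi(X_{j})\big)\right\rvert\leqslant C\sum_{j=m}^{n}\mathbb{E}[\varphi(X_{j})]^{2}$$ for all integers $1\leqslant m\leqslant n$ and any nondecreasing function $\varphi:\mathbb{R}\to\mathbb{R}$ satisfying $\mathbb{E}[\varphi(X_{k})]^{2}<\infty$ for every $k\geqslant 1$. Then $$\frac{1}{n^{1/p}}\sum_{k=1}^{n}(X_{k}-\mathbb{E} X_{k})\longrightarrow 0\quad\text{almost surely as } n\to\infty.$$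
   Context: A sequence $\{X_{n},\,n\geqslant 1\}$ of random variables is stochastically dominated by a random variable $X$ if there is a constant $C'>0$ such that $\sup_{n\geqslant 1}\mathbb{P}\{\lvert X_{n}\rvert>t\}\leqslant C'\,\mathbb{P}\{\lvert X\rvert>t\}$ for all $t>0$. Here $\mathbb{E}[\varphi(X_{j})]^{2}$ means $\mathbb{E}\big[(\varphi(X_{j}))^{2}\big]$. The constant $C$ in the hypothesis does not depend on $m$, $n$ or $\varphi$. *)

theory Defs
  imports "HOL-Probability.Probability"
begin

text \<open>As with every Bochner integral, the value is only meaningful when \<open>U\<close>, \<open>V\<close> and the product
  of the centred variables are integrable, e.g. when \<open>U\<close> and \<open>V\<close> are square-integrable.\<close>

definition covariance :: "'a measure \<Rightarrow> ('a \<Rightarrow> real) \<Rightarrow> ('a \<Rightarrow> real) \<Rightarrow> real" where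
  "covariance M U V = (\<integral>\<omega>. (U \<omega> - (\<integral>x. U x \<partial>M)) * (V \<omega> - (\<integral>x. V x \<partial>M)) \<partial>M)"

text \<open>Sequences are indexed from 1; the value at index 0 is ignored. On a probability space the supremum
  is taken over a nonempty subset of \<open>[0, 1]\<close>, so it is a genuine least upper bound.\<close>

definition stochastically_dominated ::
    "'a measure \<Rightarrow> (nat \<Rightarrow> 'a \<Rightarrow> real) \<Rightarrow> ('a \<Rightarrow> real) \<Rightarrow> bool" where
  "stochastically_dominated M X Y \<longleftrightarrow>
     (\<exists>C'>0. \<forall>t>0. (SUP n\<in>{1..}. measure M {\<omega> \<in> space M. \<bar>X n \<omega>\<bar> > t})
        \<le> C' * measure M {\<omega> \<in> space M. \<bar>Y \<omega>\<bar> > t})"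

end

theory Submission
  imports Defs
begin

text \<open>
  The hypothesis controls second moments of sums over intervals of indices, but offers no maximal
  inequality. A Rademacher--Menshov argument applied to the sums truncated at one single level would
  cost logarithms, hence more than a \<open>p\<close>-th moment. Following an idea of Rio, the truncation level is
  therefore adapted to the length of the block: sums over blocks of length \<open>2 ^ j\<close> only involve the
  variables truncated at \<open>r ^ j\<close> or \<open>r ^ Suc j\<close>, with \<open>r = 2 powr (1 / p)\<close>.

  The positive and negative parts of \<open>X k\<close> are treated separately, so let \<open>Z i\<close> be nonnegative. The
  truncations \<open>min (Z i) c\<close> are, up to a sign, nondecreasing functions of the \<open>X k\<close>, so the covariance
  hypothesis bounds the variance of their sum over an interval by a constant times the sum of their second
  moments (\<open>centred_sum_second_moment_le\<close>). Passing from level \<open>j\<close> to level \<open>Suc j\<close> increases every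
  variable, so the increment over part of a block is dominated by the increment over the whole block;
  this monotonicity replaces the missing maximal inequality. Consequently every prefix sum of length
  at most \<open>2 ^ k\<close> is controlled by the sum over \<open>j \<le> k\<close> of the largest dyadic block sum of length
  \<open>2 ^ j\<close> at truncation levels \<open>j\<close> and \<open>Suc j\<close>, up to small means (\<open>prefix_sum_chaining\<close>).

  Everything else is measured by \<open>h l = D * 2 ^ l * P(\<bar>Y\<bar> > r ^ l)\<close>, with \<open>D\<close> the constant of the
  stochastic domination. Finiteness of the \<open>p\<close>-th moment of \<open>Y\<close> says precisely that \<open>h\<close> is summable.
  The expected squares of the block sums, divided by \<open>r ^ (2 * k)\<close>, are bounded by geometric
  sequences of ratio below 1 and their convolutions with \<open>h\<close>, because \<open>2 / r\<^sup>2 < 1\<close> for \<open>p < 2\<close>. This leaves room for a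
  further geometric weight in \<open>k - j\<close>, which makes the sum over the levels \<open>j\<close> harmless
  (\<open>AE_truncated_prefix_bound\<close>). Summability of \<open>h\<close> also gives, by Borel--Cantelli, that eventually no
  \<open>Z i\<close> with \<open>i < 2 ^ k\<close> exceeds \<open>r ^ k\<close> (\<open>AE_eventually_below_truncation_level\<close>), and that the bias
  introduced by truncating is negligible, here because \<open>r \<le> 2\<close>, that is \<open>p \<ge> 1\<close> (\<open>truncation_bias\<close>).
\<close>

section \<open>Geometric convolutions\<close>

lemma summable_geometric_convolution:
  fixes c :: "nat \<Rightarrow> real"
  assumes "summable c" "\<And>j. 0 \<le> c j" "0 \<le> x" "x < 1"
  shows "summable (\<lambda>k. \<Sum>j\<le>k. x ^ (k - j) * c j)"
proof -
  have "summable (\<lambda>k. \<Sum>j\<le>k. c j * x ^ (k - j))"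
    by (rule summable_Cauchy_product) (use assms in \<open>auto intro!: summable_geometric\<close>)
  then show ?thesis by (simp add: mult.commute)
qed

lemma geometric_sum_reversed_le:
  fixes x :: real
  assumes "0 \<le> x" "x < 1"
  shows "(\<Sum>j\<le>k. x ^ (k - j)) \<le> 1 / (1 - x)"
proof -
  have "(\<Sum>j\<le>k. x ^ (k - j)) = (\<Sum>j\<le>k. x ^ j)"
    using sum.nat_diff_reindex[of "\<lambda>j. x ^ j" "Suc k"]
    by (simp only: lessThan_Suc_atMost diff_Suc_Suc)
  also have "\<dots> \<le> (\<Sum>j. x ^ j)"
    by (rule sum_le_suminf) (use assms in \<open>auto intro!: summable_geometric\<close>)
  also have "\<dots> = 1 / (1 - x)"
    using assms by (simp add: suminf_geometric)
  finally show ?thesis .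
qed

section \<open>Chaining over dyadic blocks with growing truncation levels\<close>

text \<open>
  Think of \<open>u j i\<close> as the \<open>i\<close>-th variable truncated at level \<open>j\<close> and centred; \<open>m j\<close> bounds the change of
  the mean. A prefix of a block of length \<open>2 ^ Suc j\<close> is a prefix of its left half, or its left half
  followed by a prefix of its right half. The shorter prefix is treated by induction after replacing
  level \<open>Suc j\<close> by level \<open>j\<close>. Since the increments of \<open>u\<close> are bounded below by \<open>- m j\<close>, the error of
  this replacement is at most the increment over the whole block plus \<open>2 ^ Suc j * m j\<close>, so only
  complete dyadic blocks have to be controlled.
\<close>

lemma prefix_sum_chaining:
  fixes u :: "nat \<Rightarrow> nat \<Rightarrow> real" and m \<eta> :: "nat \<Rightarrow> real"
  assumes step: "\<And>j i. u j i \<le> u (Suc j) i + m j"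
    and m: "\<And>j. 0 \<le> m j"
    and block: "\<And>j b. j \<le> k \<Longrightarrow> b < 2 ^ (k - j) \<Longrightarrow>
      \<bar>\<Sum>i=b * 2 ^ j..<b * 2 ^ j + 2 ^ j. u j i\<bar> \<le> \<eta> j"
    and block_next: "\<And>j b. j \<le> k \<Longrightarrow> b < 2 ^ (k - j) \<Longrightarrow>
      \<bar>\<Sum>i=b * 2 ^ j..<b * 2 ^ j + 2 ^ j. u (Suc j) i\<bar> \<le> \<eta> j"
  shows "j \<le> k \<Longrightarrow> b < 2 ^ (k - j) \<Longrightarrow> n \<le> 2 ^ j \<Longrightarrow>
    \<bar>\<Sum>i=b * 2 ^ j..<b * 2 ^ j + n. u j i\<bar> \<le> \<eta> 0 + (\<Sum>l<j. 5 * \<eta> l + 2 ^ Suc l * m l)"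
proof (induction j arbitrary: b n)
  case 0
  from 0 have "n = 0 \<or> n = 1" by auto
  then show ?case using block[of 0 b] 0 by auto
next
  case (Suc j)
  define s where "s = b * 2 ^ Suc j"
  define h :: nat where "h = 2 ^ j"
  define R where "R = \<eta> 0 + (\<Sum>l<j. 5 * \<eta> l + 2 ^ Suc l * m l)"
  define w where "w i = u (Suc j) i - u j i" for i
  have pow: "2 ^ (k - j) = 2 * (2 ^ (k - Suc j) :: nat)"
    using Suc.prems(1) by (metis Suc_diff_le diff_Suc_Suc power_Suc Suc_diff_Suc Suc_le_eq)
  have jk: "j \<le> k" and b0: "2 * b < 2 ^ (k - j)" and b1: "2 * b + 1 < 2 ^ (k - j)"
    using Suc.prems pow by auto
  have s0: "s = 2 * b * 2 ^ j" and s1: "s + h = (2 * b + 1) * 2 ^ j"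
    and s2: "s + 2 * h = (2 * b + 1) * 2 ^ j + 2 ^ j"
    by (auto simp: s_def h_def algebra_simps)
  have IH0: "\<bar>\<Sum>i=s..<s + n'. u j i\<bar> \<le> R" if "n' \<le> h" for n'
    using Suc.IH[OF jk b0, of n'] that by (simp add: s0 h_def R_def)
  have IH1: "\<bar>\<Sum>i=s + h..<s + h + n'. u j i\<bar> \<le> R" if "n' \<le> h" for n'
    using Suc.IH[OF jk b1, of n'] that unfolding s1 by (simp add: h_def R_def)
  have B0: "\<bar>\<Sum>i=s..<s + h. u j i\<bar> \<le> \<eta> j" "\<bar>\<Sum>i=s..<s + h. u (Suc j) i\<bar> \<le> \<eta> j"
    using block[OF jk b0] block_next[OF jk b0] by (simp_all add: s0 h_def)
  have B1: "\<bar>\<Sum>i=s + h..<s + 2 * h. u j i\<bar> \<le> \<eta> j" "\<bar>\<Sum>i=s + h..<s + 2 * h. u (Suc j) i\<bar> \<le> \<eta> j"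
    using block[OF jk b1] block_next[OF jk b1] unfolding s1 s2 by simp_all
  have w_ge: "- m j \<le> w i" for i using step[of j i] by (simp add: w_def)
  \<comment> \<open>Two half blocks, each at two truncation levels, account for the factor 4.\<close>
  have w_block: "(\<Sum>i=s..<s + 2 * h. w i) \<le> 4 * \<eta> j"
  proof -
    have "(\<Sum>i=s..<s + 2 * h. w i) = (\<Sum>i=s..<s + h. w i) + (\<Sum>i=s + h..<s + 2 * h. w i)"
      by (rule sum.atLeastLessThan_concat[symmetric]) auto
    then show ?thesis using B0 B1 by (simp add: w_def sum_subtractf)
  qed
  have \<eta>: "0 \<le> \<eta> j"
    using B0 by linarith
  \<comment> \<open>\<open>w + m j\<close> is nonnegative, so its sum over a part is at most its sum over the whole block.\<close>
  have w_part: "\<bar>\<Sum>i=x..<y. w i\<bar> \<le> 4 * \<eta> j + 2 * h * m j"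
    if "s \<le> x" "x \<le> y" "y \<le> s + 2 * h" for x y
  proof -
    have pos: "0 \<le> w i + m j" for i
      using w_ge[of i] by simp
    have "0 \<le> (\<Sum>i=x..<y. w i + m j)"
      by (rule sum_nonneg) (rule pos)
    moreover have "(\<Sum>i=x..<y. w i + m j) \<le> (\<Sum>i=s..<s + 2 * h. w i + m j)"
      by (rule sum_mono2) (use that pos in auto)
    moreover have "(\<Sum>i=s..<s + 2 * h. w i + m j) \<le> 4 * \<eta> j + 2 * h * m j"
      using w_block by (simp add: sum.distrib)
    moreover have "(\<Sum>i=x..<y. w i + m j) = (\<Sum>i=x..<y. w i) + real (y - x) * m j"
      by (simp add: sum.distrib)
    moreover have "0 \<le> real (y - x) * m j" "real (y - x) * m j \<le> real (2 * h) * m j"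
      using that m[of j] by (auto intro!: mult_right_mono mult_nonneg_nonneg simp del: of_nat_mult)
    ultimately show ?thesis using \<eta> by simp
  qed
  have split_w: "(\<Sum>i=x..<y. u (Suc j) i) = (\<Sum>i=x..<y. u j i) + (\<Sum>i=x..<y. w i)" for x y
    by (simp add: w_def flip: sum.distrib)
  have goal: "\<bar>\<Sum>i=s..<s + n. u (Suc j) i\<bar> \<le> R + (5 * \<eta> j + 2 * h * m j)"
  proof (cases "n \<le> h")
    case True
    then show ?thesis
      using IH0[OF True] w_part[of s "s + n"] \<eta> unfolding split_w by auto
  next
    case False
    then obtain n' where n': "n = h + n'" "n' \<le> h"
      using Suc.prems(3) by (metis add_le_cancel_left h_def le_add_diff_inverse mult_2 nat_le_linear power_Suc)
    have "(\<Sum>i=s..<s + n. u (Suc j) i)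
      = (\<Sum>i=s..<s + h. u (Suc j) i) + (\<Sum>i=s + h..<s + h + n'. u (Suc j) i)"
      unfolding n' add.assoc[symmetric] by (rule sum.atLeastLessThan_concat[symmetric]) auto
    moreover have "\<bar>\<Sum>i=s + h..<s + h + n'. u (Suc j) i\<bar> \<le> R + (4 * \<eta> j + 2 * h * m j)"
      using IH1[OF n'(2)] w_part[of "s + h" "s + h + n'"] n'(2) unfolding split_w by auto
    ultimately show ?thesis using B0(2) by auto
  qed
  then show ?case by (simp add: s_def h_def R_def)
qed

section \<open>Two facts about moments and almost sure convergence\<close>

text \<open>
  For \<open>z\<close> above 1, the largest \<open>l < j\<close> with \<open>r ^ l < z\<close> gives a summand that alone dominates the square,
  because \<open>min z (r ^ j)\<close> is then at most \<open>r ^ Suc l\<close>; for \<open>j = 0\<close> or \<open>z \<le> 1\<close> the constant 1 suffices. This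
  discrete form of integration over the layers only involves the tails at the points \<open>r ^ l\<close>.
\<close>

lemma min_sq_layer_bound:
  fixes z r :: real
  assumes "0 \<le> z" "1 \<le> r"
  shows "(min z (r ^ j))\<^sup>2 \<le> 1 + (\<Sum>l<j. r ^ (2 * Suc l) * of_bool (r ^ l < z))"
proof (induction j)
  case 0
  show ?case using assms by (simp add: power_le_one min_def)
next
  case (Suc j)
  have mono: "r ^ j \<le> r ^ Suc j" using assms by (intro power_increasing) auto
  show ?case
  proof (cases "r ^ j < z")
    case True
    have "(min z (r ^ Suc j))\<^sup>2 \<le> (r ^ Suc j)\<^sup>2"
      using assms by (intro power_mono) auto
    also have "\<dots> = r ^ (2 * Suc j)"
      by (rule power_even_eq[symmetric])
    also have "\<dots> \<le> 1 + (\<Sum>l<j. r ^ (2 * Suc l) * of_bool (r ^ l < z)) + r ^ (2 * Suc j)"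
      using assms by (auto intro!: add_nonneg_nonneg sum_nonneg)
    finally show ?thesis using True by simp
  next
    case False
    then have "min z (r ^ Suc j) = min z (r ^ j)" using mono by auto
    then show ?thesis using Suc False by simp
  qed
qed

text \<open>The series over all \<open>k\<close> has finite expectation, so it converges almost surely.\<close>

lemma (in prob_space) AE_tendsto_0_if_expectations_summable:
  fixes q :: "nat \<Rightarrow> 'a \<Rightarrow> real"
  assumes q: "\<And>k. integrable M (q k)" "\<And>k \<omega>. 0 \<le> q k \<omega>"
    and E: "summable (\<lambda>k. expectation (q k))"
  shows "AE \<omega> in M. (\<lambda>k. q k \<omega>) \<longlonglongrightarrow> 0"
proof -
  have [measurable]: "q k \<in> borel_measurable M" for k
    using q(1) by (rule borel_measurable_integrable)
  have term_eq: "(\<integral>\<^sup>+\<omega>. ennreal (q k \<omega>) \<partial>M) = ennreal (expectation (q k))" for k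
    by (rule nn_integral_eq_integral) (use q in auto)
  have "(\<integral>\<^sup>+\<omega>. (\<Sum>k. ennreal (q k \<omega>)) \<partial>M) = (\<Sum>k. ennreal (expectation (q k)))"
    by (subst nn_integral_suminf) (measurable, simp only: term_eq)
  also have "\<dots> \<noteq> \<infinity>"
    unfolding infinity_ennreal_def
    by (rule ennreal_suminf_neq_top[OF E]) (intro integral_nonneg_AE AE_I2 q(2))
  finally have finite: "(\<integral>\<^sup>+\<omega>. (\<Sum>k. ennreal (q k \<omega>)) \<partial>M) \<noteq> \<infinity>" .
  have "AE \<omega> in M. (\<Sum>k. ennreal (q k \<omega>)) \<noteq> \<infinity>"
    by (rule nn_integral_noteq_infinite[OF _ finite]) measurable
  then show ?thesis
  proof eventually_elim
    case (elim \<omega>)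
    have "summable (\<lambda>k. q k \<omega>)"
      by (rule summable_suminf_not_top) (use elim q(2) in simp_all)
    then show ?case by (rule summable_LIMSEQ_zero)
  qed
qed

section \<open>Nonnegative variables with summable dyadic tails\<close>

text \<open>
  The setting to which each of the positive and negative parts of the sequence is reduced. In terms of
  \<open>p\<close>, the conditions \<open>2 < r\<^sup>2\<close> and \<open>r \<le> 2\<close> on \<open>r = 2 powr (1 / p)\<close> mean \<open>p < 2\<close> and \<open>p \<ge> 1\<close>.
\<close>

locale dominated_quasi_orthogonal = prob_space M for M :: "'a measure" +
  fixes Z :: "nat \<Rightarrow> 'a \<Rightarrow> real" and r K :: real and h :: "nat \<Rightarrow> real"
  assumes Z_measurable [measurable]: "\<And>i. Z i \<in> borel_measurable M"
    and Z_nonneg: "\<And>i \<omega>. 0 \<le> Z i \<omega>"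
    and r_pos: "0 < r" and r_sq: "2 < r\<^sup>2" and r_le: "r \<le> 2"
    and h_summable: "summable h"
    and tail: "\<And>i l. prob {\<omega> \<in> space M. r ^ l < Z i \<omega>} \<le> h l / 2 ^ l"
    and K_nonneg: "0 \<le> K"
    and block_variance: "\<And>c a n. 0 \<le> c \<Longrightarrow>
      expectation (\<lambda>\<omega>. (\<Sum>i=a..<a + n. min (Z i \<omega>) c - expectation (\<lambda>x. min (Z i x) c))\<^sup>2)
        \<le> K * (\<Sum>i=a..<a + n. expectation (\<lambda>\<omega>. (min (Z i \<omega>) c)\<^sup>2))"
begin

definition trunc :: "nat \<Rightarrow> nat \<Rightarrow> 'a \<Rightarrow> real" where
  "trunc l i \<omega> = min (Z i \<omega>) (r ^ l)"

definition centred :: "nat \<Rightarrow> nat \<Rightarrow> 'a \<Rightarrow> real" where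
  "centred l i \<omega> = trunc l i \<omega> - expectation (trunc l i)"

text \<open>
  Summing the squares over all blocks of length \<open>2 ^ j\<close> below \<open>2 ^ k\<close> bounds the largest of these block
  sums. Both truncation levels occurring in the chaining step are included.
\<close>

definition block_energy :: "nat \<Rightarrow> nat \<Rightarrow> 'a \<Rightarrow> real" where
  "block_energy k j \<omega> = (\<Sum>b<2 ^ (k - j).
     (\<Sum>i=b * 2 ^ j..<b * 2 ^ j + 2 ^ j. centred j i \<omega>)\<^sup>2 +
     (\<Sum>i=b * 2 ^ j..<b * 2 ^ j + 2 ^ j. centred (Suc j) i \<omega>)\<^sup>2)"

lemma r_gt_1: "1 < r"
proof (rule ccontr)
  assume "\<not> 1 < r"
  then have "r\<^sup>2 \<le> 1" using r_pos by (simp add: power_le_one)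
  then show False using r_sq by simp
qed

lemma h_nonneg: "0 \<le> h l"
proof -
  have "0 \<le> h l / 2 ^ l" using tail[of l 0] by (meson measure_nonneg order_trans)
  then have "0 \<le> h l / 2 ^ l * 2 ^ l" by (intro mult_nonneg_nonneg) auto
  then show ?thesis by simp
qed

lemma trunc_measurable [measurable]: "trunc l i \<in> borel_measurable M"
  unfolding trunc_def[abs_def] by measurable

lemma centred_measurable [measurable]: "centred l i \<in> borel_measurable M"
  unfolding centred_def[abs_def] by measurable

lemma trunc_nonneg: "0 \<le> trunc l i \<omega>"
  using Z_nonneg r_pos by (simp add: trunc_def)

lemma trunc_le: "trunc l i \<omega> \<le> r ^ l"
  by (simp add: trunc_def)

lemma trunc_integrable [simp]: "integrable M (trunc l i)"
  by (rule integrable_const_bound[where B = "r ^ l"]) (auto simp: trunc_nonneg trunc_le)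

lemma trunc_sq_integrable [simp]: "integrable M (\<lambda>\<omega>. (trunc l i \<omega>)\<^sup>2)"
  by (rule integrable_const_bound[where B = "(r ^ l)\<^sup>2"])
     (auto intro!: power_mono simp: trunc_nonneg trunc_le)

lemma centred_abs_le: "\<bar>centred l i \<omega>\<bar> \<le> r ^ l"
proof -
  have "0 \<le> expectation (trunc l i)" by (intro integral_nonneg_AE) (simp add: trunc_nonneg)
  moreover have "expectation (trunc l i) \<le> r ^ l" by (intro integral_le_const) (simp_all add: trunc_le)
  ultimately show ?thesis
    using trunc_nonneg[of l i \<omega>] trunc_le[of l i \<omega>] by (simp add: centred_def)
qed

lemma centred_block_sq_integrable [simp]:
  "integrable M (\<lambda>\<omega>. (\<Sum>i=a..<a + n. centred l i \<omega>)\<^sup>2)"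
proof (rule integrable_const_bound[where B = "(n * r ^ l)\<^sup>2"])
  have "\<bar>\<Sum>i=a..<a + n. centred l i \<omega>\<bar> \<le> n * r ^ l" for \<omega>
  proof -
    have "\<bar>\<Sum>i=a..<a + n. centred l i \<omega>\<bar> \<le> (\<Sum>i=a..<a + n. \<bar>centred l i \<omega>\<bar>)" by (rule sum_abs)
    also have "\<dots> \<le> (\<Sum>i=a..<a + n. r ^ l)" by (intro sum_mono centred_abs_le)
    finally show ?thesis by simp
  qed
  then show "AE \<omega> in M. norm ((\<Sum>i=a..<a + n. centred l i \<omega>)\<^sup>2) \<le> (n * r ^ l)\<^sup>2"
    by (intro AE_I2) (metis abs_ge_zero power2_abs power_mono real_norm_def abs_power2)
qed measurable

lemma expectation_tail_indicator:
  "expectation (\<lambda>\<omega>. of_bool (r ^ l < Z i \<omega>)) \<le> h l / 2 ^ l"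
proof -
  let ?A = "{\<omega> \<in> space M. r ^ l < Z i \<omega>}"
  have "expectation (\<lambda>\<omega>. of_bool (r ^ l < Z i \<omega>)) = expectation (indicator ?A)"
    by (intro Bochner_Integration.integral_cong) (auto simp: indicator_def)
  also have "\<dots> = prob (?A \<inter> space M)"
    by (rule Bochner_Integration.integral_indicator)
  also have "?A \<inter> space M = ?A" by auto
  finally show ?thesis using tail by simp
qed

lemma tail_indicator_integrable [simp]:
  "integrable M (\<lambda>\<omega>. of_bool (r ^ l < Z i \<omega>) :: real)"
  by (rule integrable_const_bound[where B = 1]) auto

text \<open>The bound on \<open>E (trunc j i)\<^sup>2\<close>, uniform in \<open>i\<close>, that results from \<open>min_sq_layer_bound\<close>.\<close>

definition second_moment :: "nat \<Rightarrow> real" where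
  "second_moment j = 1 + (\<Sum>l<j. r ^ (2 * Suc l) * (h l / 2 ^ l))"

lemma expectation_trunc_sq_le: "expectation (\<lambda>\<omega>. (trunc j i \<omega>)\<^sup>2) \<le> second_moment j"
proof -
  have "expectation (\<lambda>\<omega>. (trunc j i \<omega>)\<^sup>2)
      \<le> expectation (\<lambda>\<omega>. 1 + (\<Sum>l<j. r ^ (2 * Suc l) * of_bool (r ^ l < Z i \<omega>)))"
  proof (intro integral_mono)
    show "(trunc j i \<omega>)\<^sup>2 \<le> 1 + (\<Sum>l<j. r ^ (2 * Suc l) * of_bool (r ^ l < Z i \<omega>))" for \<omega>
      unfolding trunc_def using Z_nonneg r_gt_1 by (intro min_sq_layer_bound) auto
    show "integrable M (\<lambda>\<omega>. 1 + (\<Sum>l<j. r ^ (2 * Suc l) * of_bool (r ^ l < Z i \<omega>)))"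
      by (intro Bochner_Integration.integrable_add Bochner_Integration.integrable_sum integrable_mult_right tail_indicator_integrable) simp
  qed simp
  also have "\<dots> = 1 + (\<Sum>l<j. r ^ (2 * Suc l) * expectation (\<lambda>\<omega>. of_bool (r ^ l < Z i \<omega>)))"
    by (subst Bochner_Integration.integral_add, simp,
        intro Bochner_Integration.integrable_sum integrable_mult_right tail_indicator_integrable,
        subst Bochner_Integration.integral_sum)
       (auto simp: prob_space simp del: power_Suc mult_Suc_right sum_mult_of_bool_eq)
  also have "\<dots> \<le> second_moment j"
    unfolding second_moment_def using r_pos
    by (intro add_left_mono sum_mono mult_left_mono expectation_tail_indicator) auto
  finally show ?thesis .
qed

lemma second_moment_mono: "second_moment j \<le> second_moment (Suc j)"
  using h_nonneg[of j] r_pos by (simp add: second_moment_def)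

text \<open>
  The factor \<open>(2 / r\<^sup>2) ^ j\<close> is the number \<open>2 ^ j\<close> of variables divided by the square of the
  normalization \<open>r ^ j\<close>. With it the \<open>l\<close>-th layer contributes \<open>(2 / r\<^sup>2) ^ (j - l) * h l\<close>, up to a
  constant factor, which is a geometric convolution of \<open>h\<close>.
\<close>

lemma second_moment_summable: "summable (\<lambda>j. (2 / r\<^sup>2) ^ j * second_moment (Suc j))"
proof -
  define \<theta> where "\<theta> = 2 / r\<^sup>2"
  have \<theta>: "0 < \<theta>" "\<theta> < 1" using r_pos r_sq by (auto simp: \<theta>_def)
  have "\<theta> ^ j * second_moment (Suc j) = \<theta> ^ j + r\<^sup>2 * (\<Sum>l\<le>j. \<theta> ^ (j - l) * h l)" for j
  proof -
    have "\<theta> ^ j * (r ^ (2 * Suc l) * (h l / 2 ^ l)) = r\<^sup>2 * (\<theta> ^ (j - l) * h l)" if "l \<le> j" for l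
    proof -
      have "\<theta> ^ j = \<theta> ^ (j - l) * \<theta> ^ l" using that by (simp flip: power_add)
      then have "\<theta> ^ j * (r ^ (2 * Suc l) * (h l / 2 ^ l)) = \<theta> ^ (j - l) * (\<theta> ^ l * r ^ (2 * Suc l)) * (h l / 2 ^ l)"
        by (simp only: mult.assoc)
      also have "\<theta> ^ l * r ^ (2 * Suc l) = 2 ^ l * r\<^sup>2"
      proof -
        have "r ^ (2 * Suc l) = (r\<^sup>2) ^ l * r\<^sup>2"
          by (simp only: power_mult power_Suc2)
        then have "\<theta> ^ l * r ^ (2 * Suc l) = (\<theta> * r\<^sup>2) ^ l * r\<^sup>2"
          by (simp only: power_mult_distrib mult.assoc)
        moreover have "\<theta> * r\<^sup>2 = 2" using r_pos by (simp add: \<theta>_def)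
        ultimately show ?thesis by (simp only:)
      qed
      finally show ?thesis by simp
    qed
    then show ?thesis
      unfolding second_moment_def lessThan_Suc_atMost distrib_left sum_distrib_left mult_1_right
      by (intro arg_cong2[where f = "(+)"] refl sum.cong) auto
  qed
  moreover have "summable (\<lambda>j. \<theta> ^ j + r\<^sup>2 * (\<Sum>l\<le>j. \<theta> ^ (j - l) * h l))"
    using \<theta> by (intro summable_add summable_mult summable_geometric_convolution h_summable h_nonneg) (auto intro!: summable_geometric)
  ultimately show ?thesis unfolding \<theta>_def[symmetric] by (simp only:)
qed

lemma block_energy_nonneg: "0 \<le> block_energy k j \<omega>"
  unfolding block_energy_def by (intro sum_nonneg) simp

lemma block_energy_integrable [simp]: "integrable M (block_energy k j)"
  unfolding block_energy_def[abs_def]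
  by (intro Bochner_Integration.integrable_sum Bochner_Integration.integrable_add centred_block_sq_integrable)

lemma expectation_block_energy_le:
  assumes "j \<le> k"
  shows "expectation (block_energy k j) \<le> 2 * K * 2 ^ k * second_moment (Suc j)"
proof -
  have one: "expectation (\<lambda>\<omega>. (\<Sum>i=a..<a + 2 ^ j. centred l i \<omega>)\<^sup>2) \<le> K * (2 ^ j * second_moment (Suc j))"
    if "l = j \<or> l = Suc j" for l a
  proof -
    have "expectation (\<lambda>\<omega>. (\<Sum>i=a..<a + 2 ^ j. centred l i \<omega>)\<^sup>2)
        \<le> K * (\<Sum>i=a..<a + 2 ^ j. expectation (\<lambda>\<omega>. (trunc l i \<omega>)\<^sup>2))"
      using block_variance[of "r ^ l" a "2 ^ j"] r_pos by (simp add: centred_def trunc_def[abs_def])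
    also have "\<dots> \<le> K * (\<Sum>i=a..<a + 2 ^ j. second_moment (Suc j))"
      using that order_trans[OF expectation_trunc_sq_le second_moment_mono]
      by (intro mult_left_mono sum_mono K_nonneg) (auto intro: expectation_trunc_sq_le)
    finally show ?thesis by simp
  qed
  have "expectation (block_energy k j) = (\<Sum>b<2 ^ (k - j).
     expectation (\<lambda>\<omega>. (\<Sum>i=b * 2 ^ j..<b * 2 ^ j + 2 ^ j. centred j i \<omega>)\<^sup>2) +
     expectation (\<lambda>\<omega>. (\<Sum>i=b * 2 ^ j..<b * 2 ^ j + 2 ^ j. centred (Suc j) i \<omega>)\<^sup>2))"
    unfolding block_energy_def[abs_def]
    by (subst Bochner_Integration.integral_sum) (auto intro!: sum.cong Bochner_Integration.integral_add)
  also have "\<dots> \<le> (\<Sum>b<(2::nat) ^ (k - j). K * (2 ^ j * second_moment (Suc j)) + K * (2 ^ j * second_moment (Suc j)))"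
    by (intro sum_mono add_mono one) auto
  also have "\<dots> = 2 * K * (2 ^ (k - j) * 2 ^ j) * second_moment (Suc j)"
    by simp
  also have "(2::real) ^ (k - j) * 2 ^ j = 2 ^ k"
    using assms by (simp flip: power_add)
  finally show ?thesis .
qed

text \<open>
  The two truncations differ only where \<open>Z i\<close> exceeds \<open>r ^ l\<close>, and by at most \<open>r ^ Suc l\<close>.
\<close>

lemma mean_increment:
  "0 \<le> expectation (trunc (Suc l) i) - expectation (trunc l i)"
  "expectation (trunc (Suc l) i) - expectation (trunc l i) \<le> r ^ Suc l * (h l / 2 ^ l)"
proof -
  have mono: "r ^ l \<le> r ^ Suc l" using r_gt_1 by (intro power_increasing) auto
  have "expectation (trunc l i) \<le> expectation (trunc (Suc l) i)"
    by (intro integral_mono) (use mono in \<open>auto simp: trunc_def\<close>)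
  then show "0 \<le> expectation (trunc (Suc l) i) - expectation (trunc l i)" by simp
  have "expectation (trunc (Suc l) i)
      \<le> expectation (\<lambda>\<omega>. trunc l i \<omega> + r ^ Suc l * of_bool (r ^ l < Z i \<omega>))"
  proof (intro integral_mono)
    fix \<omega>
    show "trunc (Suc l) i \<omega> \<le> trunc l i \<omega> + r ^ Suc l * of_bool (r ^ l < Z i \<omega>)"
      using mono zero_le_power[of r l, OF less_imp_le[OF r_pos]] unfolding trunc_def
      by (cases "r ^ l < Z i \<omega>") (auto simp: min_def simp del: power_Suc)
  qed simp_all
  also have "\<dots> = expectation (trunc l i) + r ^ Suc l * expectation (\<lambda>\<omega>. of_bool (r ^ l < Z i \<omega>))"
    by simp
  also have "\<dots> \<le> expectation (trunc l i) + r ^ Suc l * (h l / 2 ^ l)"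
    using r_pos by (intro add_left_mono mult_left_mono expectation_tail_indicator) auto
  finally show "expectation (trunc (Suc l) i) - expectation (trunc l i) \<le> r ^ Suc l * (h l / 2 ^ l)"
    by simp
qed

lemma tail_sum_nonneg: "0 \<le> (\<Sum>l. h (l + k))"
  using h_summable by (intro suminf_nonneg) (simp_all add: h_nonneg summable_iff_shift)

text \<open>
  The means of the truncations increase to the mean of \<open>Z i\<close> by monotone convergence, so the bias is
  the sum of the increments of the means beyond level \<open>k\<close>. The increment at \<open>l + k\<close> carries the factor
  \<open>(r / 2) ^ (l + k)\<close>, and \<open>(r / 2) ^ l\<close> may be dropped because \<open>r \<le> 2\<close>. Added over \<open>2 ^ k\<close> indices,
  the bound becomes \<open>r ^ k\<close> times a tail of the convergent series of \<open>h\<close>.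
\<close>

lemma truncation_bias:
  shows Z_integrable: "integrable M (Z i)"
    and "0 \<le> expectation (Z i) - expectation (trunc k i)"
    and "expectation (Z i) - expectation (trunc k i) \<le> r * (r / 2) ^ k * (\<Sum>l. h (l + k))"
proof -
  define e where "e l = expectation (trunc l i)" for l
  define d where "d l = e (Suc l) - e l" for l
  have d_nonneg: "0 \<le> d l" for l
    using mean_increment(1)[of l i] by (simp add: d_def e_def)
  have d_le: "d (l + k) \<le> r * (r / 2) ^ k * h (l + k)" for l k
  proof -
    have "d (l + k) \<le> r * (r / 2) ^ (l + k) * h (l + k)"
      using mean_increment(2)[of "l + k" i] by (simp add: d_def e_def power_divide)
    also have "\<dots> \<le> r * (r / 2) ^ k * h (l + k)"
      using r_pos r_le by (intro mult_right_mono mult_left_mono power_decreasing h_nonneg) auto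
    finally show ?thesis .
  qed
  have d_summable: "summable d"
  proof (rule summable_comparison_test')
    show "summable (\<lambda>l. r * h l)" by (intro summable_mult h_summable)
    show "norm (d l) \<le> r * h l" for l using d_le[of l 0] d_nonneg[of l] by simp
  qed
  have e_eq: "e k = e 0 + (\<Sum>l<k. d l)" for k
    unfolding d_def sum_lessThan_telescope by simp
  have "(\<lambda>k. e 0 + (\<Sum>l<k. d l)) \<longlonglongrightarrow> e 0 + suminf d"
    by (intro tendsto_add tendsto_const summable_LIMSEQ d_summable)
  then have e_lim: "e \<longlonglongrightarrow> e 0 + suminf d"
    by (simp flip: e_eq)
  have mono: "mono (\<lambda>l. trunc l i \<omega>)" for \<omega>
    unfolding trunc_def using r_gt_1
    by (intro monoI min.mono order_refl power_increasing) auto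
  have lim: "(\<lambda>l. trunc l i \<omega>) \<longlonglongrightarrow> Z i \<omega>" for \<omega>
  proof -
    obtain N where N: "Z i \<omega> < r ^ N" using real_arch_pow[OF r_gt_1] by blast
    have "trunc l i \<omega> = Z i \<omega>" if "N \<le> l" for l
    proof -
      have "r ^ N \<le> r ^ l" using that r_gt_1 by (intro power_increasing) auto
      then show ?thesis using N by (simp add: trunc_def)
    qed
    then show ?thesis
      by (intro tendsto_eventually) (auto simp: eventually_sequentially)
  qed
  note conv = integral_monotone_convergence_nonneg[OF trunc_integrable AE_I2[OF mono]
    AE_I2[OF trunc_nonneg] AE_I2[OF lim] e_lim[unfolded e_def[abs_def]] Z_measurable]
  show "integrable M (Z i)" by (rule conv(1))
  have "expectation (Z i) = e 0 + suminf d"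
    using conv(2) by (simp add: e_def)
  also have "\<dots> = e k + (\<Sum>l. d (l + k))"
    using suminf_split_initial_segment[OF d_summable, of k] by (simp add: e_eq[of k])
  finally have diff: "expectation (Z i) - expectation (trunc k i) = (\<Sum>l. d (l + k))"
    by (simp add: e_def)
  have shift: "summable (\<lambda>l. d (l + k))" "summable (\<lambda>l. h (l + k))"
    using d_summable h_summable by (simp_all add: summable_iff_shift)
  show "0 \<le> expectation (Z i) - expectation (trunc k i)"
    unfolding diff by (intro suminf_nonneg shift d_nonneg)
  have "(\<Sum>l. d (l + k)) \<le> (\<Sum>l. r * (r / 2) ^ k * h (l + k))"
    by (intro suminf_le d_le shift summable_mult)
  also have "\<dots> = r * (r / 2) ^ k * (\<Sum>l. h (l + k))"
    by (rule suminf_mult[OF shift(2)])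
  finally show "expectation (Z i) - expectation (trunc k i) \<le> r * (r / 2) ^ k * (\<Sum>l. h (l + k))"
    unfolding diff .
qed

text \<open>Borel--Cantelli: the exceptional events have probability at most \<open>2 ^ k * (h k / 2 ^ k) = h k\<close>.\<close>

lemma AE_eventually_below_truncation_level:
  "AE \<omega> in M. \<forall>\<^sub>F k in sequentially. \<forall>i<2 ^ k. Z i \<omega> \<le> r ^ k"
proof -
  define A where "A k = (\<Union>i<2 ^ k. {\<omega> \<in> space M. r ^ k < Z i \<omega>})" for k :: nat
  have A [measurable]: "A k \<in> sets M" for k
    unfolding A_def by (intro sets.finite_UN) auto
  have "prob (A k) \<le> h k" for k
  proof -
    have "prob (A k) \<le> (\<Sum>i<2 ^ k. prob {\<omega> \<in> space M. r ^ k < Z i \<omega>})"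
      unfolding A_def by (intro finite_measure_subadditive_finite) auto
    also have "\<dots> \<le> (\<Sum>i<(2::nat) ^ k. h k / 2 ^ k)"
      by (intro sum_mono tail)
    finally show ?thesis by simp
  qed
  then have "summable (\<lambda>k. prob (A k))"
    by (intro summable_comparison_test'[OF h_summable]) simp
  then have "AE \<omega> in M. \<forall>\<^sub>F k in sequentially. \<omega> \<in> space M - A k"
    by (intro borel_cantelli_AE1) (simp_all add: emeasure_eq_measure)
  then show ?thesis
  proof eventually_elim
    case (elim \<omega>)
    then show ?case
      by eventually_elim (auto simp: A_def not_less)
  qed
qed

text \<open>
  The block energies are divided by \<open>r ^ (2 * k)\<close> and given the additional weight \<open>\<sigma> ^ (k - j)\<close> with
  \<open>\<sigma> > 1\<close>. Their sum \<open>q k\<close> over \<open>j \<le> k\<close> still has summable expectations as long as \<open>2 * \<sigma> < r\<^sup>2\<close>, hence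
  tends to 0 almost surely. In return, the largest block sum at level \<open>j\<close> is at most
  \<open>r ^ k * sqrt (q k) * t ^ (k - j)\<close> with \<open>t < 1\<close>, so that these terms of the chaining bound sum to a
  constant times \<open>r ^ k * sqrt (q k)\<close>. The terms coming from the means, divided by \<open>r ^ k\<close>, form a
  geometric convolution of \<open>h\<close> and tend to 0 as well.
\<close>

lemma AE_truncated_prefix_bound:
  "AE \<omega> in M. \<exists>\<rho>. \<rho> \<longlonglongrightarrow> 0 \<and>
    (\<forall>k n. n \<le> 2 ^ k \<longrightarrow> \<bar>\<Sum>i<n. centred k i \<omega>\<bar> \<le> \<rho> k * r ^ k)"
proof -
  \<comment> \<open>The strict inequality \<open>2 < r\<^sup>2\<close> leaves room for a geometric weight of ratio above 1.\<close>
  obtain \<sigma> where \<sigma>: "1 < \<sigma>" "\<sigma> < r\<^sup>2 / 2"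
    using dense[of 1 "r\<^sup>2 / 2"] r_sq by auto
  define t where "t = sqrt (1 / \<sigma>)"
  have t: "0 \<le> t" "t < 1" "t\<^sup>2 = 1 / \<sigma>" using \<sigma> by (auto simp: t_def)
  define q where "q k \<omega> = (\<Sum>j\<le>k. \<sigma> ^ (k - j) / r ^ (2 * k) * block_energy k j \<omega>)" for k \<omega>
  have q_integrable: "integrable M (q k)" for k
    unfolding q_def[abs_def]
    by (intro Bochner_Integration.integrable_sum integrable_mult_right block_energy_integrable)
  have q_nonneg: "0 \<le> q k \<omega>" for k \<omega>
    unfolding q_def using \<sigma> r_pos by (intro sum_nonneg mult_nonneg_nonneg block_energy_nonneg) auto
  define x where "x = 2 * \<sigma> / r\<^sup>2"
  have x: "0 \<le> x" "x < 1" using \<sigma> r_pos by (auto simp: x_def field_simps)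
  define g where "g j = (2 / r\<^sup>2) ^ j * second_moment (Suc j)" for j
  have g_nonneg: "0 \<le> g j" for j
    unfolding g_def second_moment_def using r_pos
    by (intro mult_nonneg_nonneg add_nonneg_nonneg sum_nonneg) (auto simp: h_nonneg)
  have q_mean: "expectation (q k) \<le> 2 * K * (\<Sum>j\<le>k. x ^ (k - j) * g j)" for k
  proof -
    have "expectation (q k) = (\<Sum>j\<le>k. \<sigma> ^ (k - j) / r ^ (2 * k) * expectation (block_energy k j))"
      unfolding q_def[abs_def]
      by (subst Bochner_Integration.integral_sum) (auto intro!: integrable_mult_right)
    also have "\<dots> \<le> (\<Sum>j\<le>k. \<sigma> ^ (k - j) / r ^ (2 * k) * (2 * K * 2 ^ k * second_moment (Suc j)))"
      using \<sigma> r_pos by (intro sum_mono mult_left_mono expectation_block_energy_le) auto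
    also have "\<dots> = (\<Sum>j\<le>k. 2 * K * (x ^ (k - j) * g j))"
    proof (intro sum.cong refl)
      fix j assume "j \<in> {..k}"
      then have k: "k = (k - j) + j" by simp
      have "x ^ (k - j) * g j = \<sigma> ^ (k - j) * (2 / r\<^sup>2) ^ ((k - j) + j) * second_moment (Suc j)"
        unfolding x_def g_def power_add by (simp add: power_mult_distrib power_divide)
      also have "(2 / r\<^sup>2) ^ ((k - j) + j) = 2 ^ k / r ^ (2 * k)"
        unfolding k[symmetric] by (simp add: power_divide power_mult)
      finally show "\<sigma> ^ (k - j) / r ^ (2 * k) * (2 * K * 2 ^ k * second_moment (Suc j))
          = 2 * K * (x ^ (k - j) * g j)"
        by simp
    qed
    finally show ?thesis by (simp add: sum_distrib_left)
  qed
  have "summable (\<lambda>k. expectation (q k))"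
  proof (rule summable_comparison_test')
    show "summable (\<lambda>k. 2 * K * (\<Sum>j\<le>k. x ^ (k - j) * g j))"
      using second_moment_summable x g_nonneg
      by (intro summable_mult summable_geometric_convolution) (auto simp: g_def[abs_def])
    show "norm (expectation (q k)) \<le> 2 * K * (\<Sum>j\<le>k. x ^ (k - j) * g j)" for k
    proof -
      have "0 \<le> expectation (q k)" by (rule integral_nonneg_AE) (simp add: q_nonneg)
      then show ?thesis using q_mean[of k] by simp
    qed
  qed
  then have "AE \<omega> in M. (\<lambda>k. q k \<omega>) \<longlonglongrightarrow> 0"
    by (intro AE_tendsto_0_if_expectations_summable q_integrable q_nonneg)
  then show ?thesis
  proof eventually_elim
    case (elim \<omega>)
    define H where "H k = (\<Sum>l\<le>k. (1 / r) ^ (k - l) * h l)" for k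
    define \<rho> where "\<rho> k = 6 / (1 - t) * sqrt (q k \<omega>) + 2 * r * H k" for k
    have "H \<longlonglongrightarrow> 0"
      unfolding H_def using r_gt_1
      by (intro summable_LIMSEQ_zero summable_geometric_convolution h_summable h_nonneg) auto
    moreover have "(\<lambda>k. sqrt (q k \<omega>)) \<longlonglongrightarrow> 0"
      using tendsto_real_sqrt[OF elim] by simp
    ultimately have "\<rho> \<longlonglongrightarrow> 6 / (1 - t) * 0 + 2 * r * 0"
      unfolding \<rho>_def by (intro tendsto_intros)
    then have \<rho>: "\<rho> \<longlonglongrightarrow> 0" by simp
    have "\<bar>\<Sum>i<n. centred k i \<omega>\<bar> \<le> \<rho> k * r ^ k" if n: "n \<le> 2 ^ k" for k n
    proof -
      define \<eta> where "\<eta> j = sqrt (block_energy k j \<omega>)" for j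
      define m where "m j = r ^ Suc j * (h j / 2 ^ j)" for j
      have block: "\<bar>\<Sum>i=b * 2 ^ j..<b * 2 ^ j + 2 ^ j. centred l i \<omega>\<bar> \<le> \<eta> j"
        if "b < 2 ^ (k - j)" "l = j \<or> l = Suc j" for b j l
      proof -
        let ?f = "\<lambda>l b. (\<Sum>i=b * 2 ^ j..<b * 2 ^ j + 2 ^ j. centred l i \<omega>)\<^sup>2"
        have "?f l b \<le> ?f j b + ?f (Suc j) b" using that(2) by auto
        also have "\<dots> \<le> block_energy k j \<omega>"
          unfolding block_energy_def
          by (rule member_le_sum[where f = "\<lambda>b. ?f j b + ?f (Suc j) b"]) (use that(1) in auto)
        finally show ?thesis unfolding \<eta>_def by (metis real_sqrt_abs real_sqrt_le_mono)
      qed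
      have m_nonneg: "0 \<le> m j" for j
        using r_pos h_nonneg[of j] by (simp add: m_def)
      have step: "centred j i \<omega> \<le> centred (Suc j) i \<omega> + m j" for j i
      proof -
        have "r ^ j \<le> r ^ Suc j" using r_gt_1 by (intro power_increasing) auto
        then have "trunc j i \<omega> \<le> trunc (Suc j) i \<omega>"
          unfolding trunc_def by (intro min.mono order_refl)
        then show ?thesis
          using mean_increment(2)[of j i] by (simp add: centred_def m_def)
      qed
      have "\<bar>\<Sum>i=0 * 2 ^ k..<0 * 2 ^ k + n. centred k i \<omega>\<bar>
          \<le> \<eta> 0 + (\<Sum>l<k. 5 * \<eta> l + 2 ^ Suc l * m l)"
        by (rule prefix_sum_chaining[where k = k]) (use step m_nonneg block n in auto)
      also have "\<dots> = \<eta> 0 + 5 * (\<Sum>l<k. \<eta> l) + 2 * r * (\<Sum>l<k. r ^ l * h l)"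
      proof -
        have "2 ^ Suc l * m l = 2 * r * (r ^ l * h l)" for l by (simp add: m_def)
        then show ?thesis by (simp only: sum.distrib sum_distrib_left add.assoc)
      qed
      also have "\<dots> \<le> (\<Sum>l\<le>k. \<eta> l) + 5 * (\<Sum>l\<le>k. \<eta> l) + 2 * r * (\<Sum>l\<le>k. r ^ l * h l)"
      proof (intro add_mono mult_left_mono)
        show "\<eta> 0 \<le> (\<Sum>l\<le>k. \<eta> l)"
          by (rule member_le_sum) (auto simp: \<eta>_def block_energy_nonneg)
        show "(\<Sum>l<k. \<eta> l) \<le> (\<Sum>l\<le>k. \<eta> l)"
          by (intro sum_mono2) (auto simp: \<eta>_def block_energy_nonneg)
        show "(\<Sum>l<k. r ^ l * h l) \<le> (\<Sum>l\<le>k. r ^ l * h l)"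
          using r_pos by (intro sum_mono2) (auto simp: h_nonneg)
      qed (use r_pos in auto)
      also have "(\<Sum>l\<le>k. r ^ l * h l) = r ^ k * H k"
      proof -
        have "r ^ l * h l = r ^ k * ((1 / r) ^ (k - l) * h l)" if "l \<le> k" for l
        proof -
          have "r ^ k = r ^ l * r ^ (k - l)" using that by (simp flip: power_add)
          then show ?thesis using r_pos by (simp add: power_divide)
        qed
        then show ?thesis unfolding H_def sum_distrib_left
          by (intro sum.cong refl) simp
      qed
      also have "(\<Sum>l\<le>k. \<eta> l) + 5 * (\<Sum>l\<le>k. \<eta> l) + 2 * r * (r ^ k * H k)
          \<le> 6 * (r ^ k * sqrt (q k \<omega>) * (1 / (1 - t))) + 2 * r * (r ^ k * H k)"
      proof -
        have "\<eta> j \<le> r ^ k * sqrt (q k \<omega>) * t ^ (k - j)" if "j \<le> k" for j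
        proof -
          have "\<sigma> ^ (k - j) / r ^ (2 * k) * block_energy k j \<omega> \<le> q k \<omega>"
            unfolding q_def
            by (rule member_le_sum[where f = "\<lambda>j. \<sigma> ^ (k - j) / r ^ (2 * k) * block_energy k j \<omega>"])
               (use that \<sigma> r_pos in \<open>auto intro!: mult_nonneg_nonneg divide_nonneg_nonneg simp: block_energy_nonneg\<close>)
          then have "block_energy k j \<omega> \<le> r ^ (2 * k) * q k \<omega> * (1 / \<sigma>) ^ (k - j)"
            using \<sigma> r_pos by (simp add: field_simps)
          also have "\<dots> = (r ^ k * sqrt (q k \<omega>) * t ^ (k - j))\<^sup>2"
            unfolding power_mult_distrib t(3)[symmetric]
            using q_nonneg by (simp add: mult.commute flip: power_mult)
          finally show ?thesis
            unfolding \<eta>_def using r_pos t q_nonneg by (intro real_le_lsqrt) auto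
        qed
        then have "(\<Sum>l\<le>k. \<eta> l) \<le> (\<Sum>l\<le>k. r ^ k * sqrt (q k \<omega>) * t ^ (k - l))"
          by (intro sum_mono) auto
        also have "\<dots> = r ^ k * sqrt (q k \<omega>) * (\<Sum>l\<le>k. t ^ (k - l))"
          by (simp add: sum_distrib_left)
        also have "\<dots> \<le> r ^ k * sqrt (q k \<omega>) * (1 / (1 - t))"
          using r_pos q_nonneg t by (intro mult_left_mono geometric_sum_reversed_le) auto
        finally show ?thesis by simp
      qed
      also have "\<dots> = \<rho> k * r ^ k"
        by (simp add: \<rho>_def algebra_simps)
      finally show ?thesis by (simp add: atLeast0LessThan)
    qed
    with \<rho> show ?case by blast
  qed
qed

text \<open>
  For large \<open>k\<close>, no variable of index below \<open>2 ^ k\<close> is changed by truncation at \<open>r ^ k\<close>, so the sums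
  differ from the truncated ones only by the bias of the means.
\<close>

lemma AE_prefix_bound:
  "AE \<omega> in M. \<exists>\<rho>. \<rho> \<longlonglongrightarrow> 0 \<and>
    (\<forall>\<^sub>F k in sequentially. \<forall>n\<le>2 ^ k. \<bar>\<Sum>i<n. Z i \<omega> - expectation (Z i)\<bar> \<le> \<rho> k * r ^ k)"
  using AE_truncated_prefix_bound AE_eventually_below_truncation_level
proof eventually_elim
  case (elim \<omega>)
  then obtain \<rho> where \<rho>: "\<rho> \<longlonglongrightarrow> 0"
    and bound: "\<And>k n. n \<le> 2 ^ k \<Longrightarrow> \<bar>\<Sum>i<n. centred k i \<omega>\<bar> \<le> \<rho> k * r ^ k"
    by blast
  define T where "T k = (\<Sum>l. h (l + k))" for k
  have "(\<lambda>k. \<rho> k + r * T k) \<longlonglongrightarrow> 0 + r * 0"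
    unfolding T_def by (intro tendsto_intros \<rho> suminf_exist_split2 h_summable)
  then have lim: "(\<lambda>k. \<rho> k + r * T k) \<longlonglongrightarrow> 0" by simp
  have "\<forall>\<^sub>F k in sequentially. \<forall>n\<le>2 ^ k.
    \<bar>\<Sum>i<n. Z i \<omega> - expectation (Z i)\<bar> \<le> (\<rho> k + r * T k) * r ^ k"
    using elim(2)
  proof eventually_elim
    case (elim k)
    show ?case
    proof (intro allI impI)
      fix n :: nat assume n: "n \<le> 2 ^ k"
      define B where "B = (\<Sum>i<n. expectation (Z i) - expectation (trunc k i))"
      have "(\<Sum>i<n. Z i \<omega> - expectation (Z i)) = (\<Sum>i<n. centred k i \<omega>) - B"
        unfolding B_def sum_subtractf[symmetric]
        by (intro sum.cong refl) (use elim n in \<open>auto simp: centred_def trunc_def\<close>)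
      moreover have "0 \<le> B"
        unfolding B_def by (intro sum_nonneg truncation_bias(2))
      moreover have "B \<le> r * T k * r ^ k"
      proof -
        have "B \<le> (\<Sum>i<n. r * (r / 2) ^ k * T k)"
          unfolding B_def T_def by (intro sum_mono truncation_bias(3))
        also have "\<dots> = real n * (r * (r / 2) ^ k * T k)" by simp
        also have "\<dots> \<le> 2 ^ k * (r * (r / 2) ^ k * T k)"
        proof (rule mult_right_mono)
          show "real n \<le> 2 ^ k" using n by (metis of_nat_le_iff of_nat_numeral of_nat_power)
        qed (use r_pos in \<open>simp add: T_def tail_sum_nonneg\<close>)
        also have "\<dots> = r * T k * r ^ k" by (simp add: power_divide)
        finally show ?thesis .
      qed
      ultimately show "\<bar>\<Sum>i<n. Z i \<omega> - expectation (Z i)\<bar> \<le> (\<rho> k + r * T k) * r ^ k"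
        using bound[OF n] by (simp add: algebra_simps)
    qed
  qed
  with lim show ?case by blast
qed

end

section \<open>From dyadic bounds to convergence\<close>

text \<open>
  Rounding \<open>n\<close> up to the power \<open>2 ^ \<kappa> n \<le> 2 * n\<close> changes the normalization at most by the factor
  \<open>2 powr (1 / p)\<close>.
\<close>

lemma tendsto_0_of_dyadic_bound:
  fixes S \<rho> :: "nat \<Rightarrow> real"
  assumes p: "0 < p" and \<rho>: "\<rho> \<longlonglongrightarrow> 0"
    and bound: "\<forall>\<^sub>F k in sequentially. \<forall>n\<le>2 ^ k. \<bar>S n\<bar> \<le> \<rho> k * (2 powr (1 / p)) ^ k"
  shows "(\<lambda>n. S n / real n powr (1 / p)) \<longlonglongrightarrow> 0"
proof -
  define \<kappa> where "\<kappa> n = nat \<lceil>log 2 (real n)\<rceil>" for n :: nat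
  have \<kappa>: "n \<le> 2 ^ \<kappa> n" "2 ^ \<kappa> n \<le> 2 * real n" if "0 < n" for n
  proof -
    have pos: "0 \<le> log 2 (real n)" using that by simp
    have "real n = 2 powr log 2 (real n)" using that by simp
    also have "\<dots> \<le> 2 powr real (\<kappa> n)" unfolding \<kappa>_def by (intro powr_mono) linarith+
    also have "\<dots> = real (2 ^ \<kappa> n)" by (simp add: powr_realpow)
    finally show "n \<le> 2 ^ \<kappa> n" by (simp only: of_nat_le_iff)
    have "(2::real) ^ \<kappa> n = 2 powr real (\<kappa> n)" by (simp add: powr_realpow)
    also have "\<dots> \<le> 2 powr (1 + log 2 (real n))"
      unfolding \<kappa>_def using pos by (intro powr_mono) linarith+
    also have "\<dots> = 2 * real n" using that by (simp add: powr_add)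
    finally show "2 ^ \<kappa> n \<le> 2 * real n" .
  qed
  have \<kappa>_lim: "filterlim \<kappa> at_top sequentially"
    unfolding filterlim_at_top
  proof
    fix N
    show "\<forall>\<^sub>F n in sequentially. N \<le> \<kappa> n"
      using eventually_ge_at_top[of "2 ^ N"]
    proof eventually_elim
      case (elim n)
      have "0 < n" using elim by (metis less_le_trans pos2 zero_less_power)
      with elim \<kappa>(1)[of n] have "(2::nat) ^ N \<le> 2 ^ \<kappa> n" by linarith
      then show ?case by simp
    qed
  qed
  have "\<forall>\<^sub>F n in sequentially. norm (S n / real n powr (1 / p)) \<le> 2 powr (1 / p) * \<bar>\<rho> (\<kappa> n)\<bar>"
    using eventually_compose_filterlim[OF bound \<kappa>_lim]
      eventually_gt_at_top[of 0]
  proof eventually_elim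
    case (elim n)
    have "(2 powr (1 / p)) ^ \<kappa> n = (2 ^ \<kappa> n) powr (1 / p)"
      by (simp add: powr_powr mult.commute flip: powr_realpow)
    also have "\<dots> \<le> (2 * real n) powr (1 / p)"
      using p elim \<kappa>(2)[of n] by (intro powr_mono2) auto
    also have "\<dots> = 2 powr (1 / p) * real n powr (1 / p)"
      by (simp add: powr_mult)
    finally have scale: "(2 powr (1 / p)) ^ \<kappa> n \<le> 2 powr (1 / p) * real n powr (1 / p)" .
    have "\<bar>S n\<bar> \<le> \<rho> (\<kappa> n) * (2 powr (1 / p)) ^ \<kappa> n"
      using elim \<kappa>(1)[of n] by blast
    also have "\<dots> \<le> \<bar>\<rho> (\<kappa> n)\<bar> * (2 powr (1 / p)) ^ \<kappa> n"
      by (intro mult_right_mono) auto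
    also have "\<dots> \<le> \<bar>\<rho> (\<kappa> n)\<bar> * (2 powr (1 / p) * real n powr (1 / p))"
      by (intro mult_left_mono scale) auto
    finally show ?case using elim by (simp add: divide_le_eq mult_ac)
  qed
  moreover have "(\<lambda>n. 2 powr (1 / p) * \<bar>\<rho> (\<kappa> n)\<bar>) \<longlonglongrightarrow> 0"
    using tendsto_mult_right_zero[OF tendsto_rabs_zero[OF filterlim_compose[OF \<rho> \<kappa>_lim]]] .
  ultimately show ?thesis by (rule Lim_null_comparison)
qed

text \<open>
  With \<open>v = \<bar>Y\<bar> powr p\<close> this bounds the partial sums of \<open>2 ^ l * P(\<bar>Y\<bar> > r ^ l)\<close> by \<open>2 * E(\<bar>Y\<bar> powr p)\<close>.
  The second bound in the minimum keeps the induction going: if \<open>2 ^ N < v\<close>, the sum grows to at most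
  \<open>2 ^ N + 2 ^ N\<close>, which is below \<open>2 * v\<close>.
\<close>

lemma sum_dyadic_below_le:
  fixes v :: real
  assumes "0 \<le> v"
  shows "(\<Sum>l<N. 2 ^ l * of_bool (2 ^ l < v)) \<le> min (2 * v) (2 ^ N)"
proof (induction N)
  case 0
  show ?case using assms by simp
next
  case (Suc N)
  then show ?case using assms by (cases "2 ^ N < v") auto
qed

section \<open>Covariances bound the second moment of a sum\<close>

lemma square_sum_diag_plus_pairs:
  fixes a :: "nat \<Rightarrow> real"
  shows "(\<Sum>i=m..n. a i)\<^sup>2
    = (\<Sum>i=m..n. (a i)\<^sup>2) + 2 * (\<Sum>(i, j)\<in>{(i, j). m \<le> i \<and> i < j \<and> j \<le> n}. a i * a j)"
proof -
  let ?f = "\<lambda>(i, j). a i * a j"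
  let ?P = "{(i, j). m \<le> i \<and> i < j \<and> j \<le> n}"
  let ?Q = "{(i, j). m \<le> j \<and> j < i \<and> i \<le> n}"
  let ?D = "(\<lambda>i. (i, i)) ` {m..n}"
  have fin: "finite ?P" "finite ?Q"
    by (rule finite_subset[of _ "{m..n} \<times> {m..n}"]; auto)+
  have "(\<Sum>i=m..n. a i)\<^sup>2 = sum ?f ({m..n} \<times> {m..n})"
    by (simp add: power2_eq_square sum_product sum.cartesian_product)
  also have "{m..n} \<times> {m..n} = ?D \<union> (?P \<union> ?Q)" by force
  also have "sum ?f \<dots> = sum ?f ?D + sum ?f (?P \<union> ?Q)"
    by (rule sum.union_disjoint) (use fin in auto)
  also have "sum ?f (?P \<union> ?Q) = sum ?f ?P + sum ?f ?Q"
    by (rule sum.union_disjoint) (use fin in auto)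
  also have "sum ?f ?Q = sum ?f ?P"
    by (rule sum.reindex_bij_witness[where i = prod.swap and j = prod.swap]) auto
  also have "sum ?f ?D = (\<Sum>i=m..n. (a i)\<^sup>2)"
    by (subst sum.reindex) (auto simp: inj_on_def power2_eq_square)
  finally show ?thesis by simp
qed

lemma (in prob_space) centred_sum_second_moment_le:
  fixes W :: "nat \<Rightarrow> 'a \<Rightarrow> real"
  assumes meas: "\<And>i. m \<le> i \<Longrightarrow> W i \<in> borel_measurable M"
    and bounded: "\<And>i \<omega>. m \<le> i \<Longrightarrow> \<bar>W i \<omega>\<bar> \<le> B"
    and cov: "\<bar>\<Sum>(i, j)\<in>{(i, j). m \<le> i \<and> i < j \<and> j \<le> n}. covariance M (W i) (W j)\<bar>
      \<le> C * (\<Sum>i=m..n. expectation (\<lambda>\<omega>. (W i \<omega>)\<^sup>2))"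
  shows "expectation (\<lambda>\<omega>. (\<Sum>i=m..n. W i \<omega> - expectation (W i))\<^sup>2)
    \<le> (1 + 2 * C) * (\<Sum>i=m..n. expectation (\<lambda>\<omega>. (W i \<omega>)\<^sup>2))"
proof -
  let ?P = "{(i, j). m \<le> i \<and> i < j \<and> j \<le> n}"
  define V where "V i \<omega> = W i \<omega> - expectation (W i)" for i \<omega>
  have W_int: "integrable M (W i)" if "m \<le> i" for i
    using bounded meas that by (intro integrable_const_bound[where B = B]) auto
  have W_sq: "integrable M (\<lambda>\<omega>. (W i \<omega>)\<^sup>2)" if "m \<le> i" for i
  proof (rule integrable_const_bound[where B = "B\<^sup>2"])
    show "AE \<omega> in M. norm ((W i \<omega>)\<^sup>2) \<le> B\<^sup>2"
      using power_mono[OF bounded[OF that] abs_ge_zero, of _ 2] by simp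
    show "(\<lambda>\<omega>. (W i \<omega>)\<^sup>2) \<in> borel_measurable M" using meas[OF that] by measurable
  qed
  have V_meas: "V i \<in> borel_measurable M" if "m \<le> i" for i
    unfolding V_def[abs_def] using meas[OF that] by measurable
  have V_bound: "\<bar>V i \<omega>\<bar> \<le> 2 * B" if "m \<le> i" for i \<omega>
  proof -
    have "\<bar>expectation (W i)\<bar> \<le> expectation (\<lambda>\<omega>. \<bar>W i \<omega>\<bar>)"
      by (rule integral_abs_bound)
    also have "\<dots> \<le> B"
      using W_int[OF that] bounded[OF that] by (intro integral_le_const) auto
    finally show ?thesis using bounded[OF that, of \<omega>] by (simp add: V_def)
  qed
  have VV: "integrable M (\<lambda>\<omega>. V i \<omega> * V j \<omega>)" if "m \<le> i" "m \<le> j" for i j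
  proof (rule integrable_const_bound[where B = "2 * B * (2 * B)"])
    show "AE \<omega> in M. norm (V i \<omega> * V j \<omega>) \<le> 2 * B * (2 * B)"
    proof (rule AE_I2)
      fix \<omega>
      have "0 \<le> 2 * B" using V_bound[OF that(1), of \<omega>] by linarith
      then show "norm (V i \<omega> * V j \<omega>) \<le> 2 * B * (2 * B)"
        unfolding real_norm_def abs_mult by (intro mult_mono V_bound that) auto
    qed
    show "(\<lambda>\<omega>. V i \<omega> * V j \<omega>) \<in> borel_measurable M"
      using V_meas[OF that(1)] V_meas[OF that(2)] by measurable
  qed
  have "expectation (\<lambda>\<omega>. (\<Sum>i=m..n. V i \<omega>)\<^sup>2)
      = expectation (\<lambda>\<omega>. (\<Sum>i=m..n. V i \<omega> * V i \<omega>) + 2 * (\<Sum>(i, j)\<in>?P. V i \<omega> * V j \<omega>))"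
    by (simp add: square_sum_diag_plus_pairs power2_eq_square[of "V _ _"])
  also have "\<dots> = expectation (\<lambda>\<omega>. \<Sum>i=m..n. V i \<omega> * V i \<omega>)
      + expectation (\<lambda>\<omega>. 2 * (\<Sum>(i, j)\<in>?P. V i \<omega> * V j \<omega>))"
    by (intro Bochner_Integration.integral_add Bochner_Integration.integrable_sum integrable_mult_right)
       (auto intro!: VV)
  also have "expectation (\<lambda>\<omega>. \<Sum>i=m..n. V i \<omega> * V i \<omega>) = (\<Sum>i=m..n. expectation (\<lambda>\<omega>. V i \<omega> * V i \<omega>))"
    by (intro Bochner_Integration.integral_sum VV) auto
  also have "expectation (\<lambda>\<omega>. 2 * (\<Sum>(i, j)\<in>?P. V i \<omega> * V j \<omega>))
      = 2 * (\<Sum>(i, j)\<in>?P. covariance M (W i) (W j))"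
  proof -
    have "expectation (\<lambda>\<omega>. \<Sum>x\<in>?P. V (fst x) \<omega> * V (snd x) \<omega>)
        = (\<Sum>x\<in>?P. expectation (\<lambda>\<omega>. V (fst x) \<omega> * V (snd x) \<omega>))"
      by (intro Bochner_Integration.integral_sum VV) auto
    then show ?thesis
      by (simp add: case_prod_beta covariance_def V_def)
  qed
  also have "(\<Sum>i=m..n. expectation (\<lambda>\<omega>. V i \<omega> * V i \<omega>)) \<le> (\<Sum>i=m..n. expectation (\<lambda>\<omega>. (W i \<omega>)\<^sup>2))"
  proof (intro sum_mono)
    fix i assume "i \<in> {m..n}"
    then have "m \<le> i" by simp
    then show "expectation (\<lambda>\<omega>. V i \<omega> * V i \<omega>) \<le> expectation (\<lambda>\<omega>. (W i \<omega>)\<^sup>2)"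
      using variance_eq[OF W_int W_sq, of i] by (simp add: V_def flip: power2_eq_square)
  qed
  also have "2 * (\<Sum>(i, j)\<in>?P. covariance M (W i) (W j)) \<le> 2 * (C * (\<Sum>i=m..n. expectation (\<lambda>\<omega>. (W i \<omega>)\<^sup>2)))"
    using cov by linarith
  finally show ?thesis by (simp add: V_def algebra_simps)
qed

section \<open>The strong law\<close>

text \<open>
  The sign \<open>\<epsilon>\<close> selects the positive or the negative part. The function
  \<open>\<phi> y = \<epsilon> * min (max (\<epsilon> * y) 0) c\<close> is nondecreasing for both signs, so the covariance hypothesis applies
  to it, and the outer factor \<open>\<epsilon>\<close> disappears on squaring. The index is shifted by one because the
  dyadic blocks start at 0.
\<close>

lemma (in prob_space) one_sided_strong_law:
  fixes X :: "nat \<Rightarrow> 'a \<Rightarrow> real" and Y :: "'a \<Rightarrow> real" and p C D \<epsilon> :: real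
  assumes p: "1 \<le> p" "p < 2"
    and X: "\<And>n. 1 \<le> n \<Longrightarrow> X n \<in> borel_measurable M"
    and Y [measurable]: "Y \<in> borel_measurable M"
    and D: "0 < D" "\<And>n t. 1 \<le> n \<Longrightarrow> 0 < t \<Longrightarrow>
      prob {\<omega> \<in> space M. t < \<bar>X n \<omega>\<bar>} \<le> D * prob {\<omega> \<in> space M. t < \<bar>Y \<omega>\<bar>}"
    and Y_p: "integrable M (\<lambda>\<omega>. \<bar>Y \<omega>\<bar> powr p)"
    and C: "0 < C"
    and cov: "\<And>m n (\<phi>::real \<Rightarrow> real).
      \<lbrakk>1 \<le> m; m \<le> n; mono \<phi>; \<And>k. k \<ge> 1 \<Longrightarrow> integrable M (\<lambda>\<omega>. (\<phi> (X k \<omega>))\<^sup>2)\<rbrakk> \<Longrightarrow>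
      \<bar>\<Sum>(i, j)\<in>{(i, j). m \<le> i \<and> i < j \<and> j \<le> n}.
          covariance M (\<lambda>\<omega>. \<phi> (X i \<omega>)) (\<lambda>\<omega>. \<phi> (X j \<omega>))\<bar>
        \<le> C * (\<Sum>j=m..n. expectation (\<lambda>\<omega>. (\<phi> (X j \<omega>))\<^sup>2))"
    and \<epsilon>: "\<epsilon> = 1 \<or> \<epsilon> = - 1"
  shows "1 \<le> n \<Longrightarrow> integrable M (\<lambda>\<omega>. max (\<epsilon> * X n \<omega>) 0)"
    and "AE \<omega> in M. (\<lambda>n. (\<Sum>k=1..n. max (\<epsilon> * X k \<omega>) 0 - expectation (\<lambda>x. max (\<epsilon> * X k x) 0))
      / real n powr (1 / p)) \<longlonglongrightarrow> 0"
proof -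
  define r where "r = 2 powr (1 / p)"
  define h where "h l = D * (2 ^ l * prob {\<omega> \<in> space M. r ^ l < \<bar>Y \<omega>\<bar>})" for l
  define Z where "Z i \<omega> = max (\<epsilon> * X (Suc i) \<omega>) 0" for i \<omega>
  have r_pos: "0 < r" by (simp add: r_def)
  have r_powr: "(r ^ l) powr p = 2 ^ l" for l
  proof -
    have "(r ^ l) powr p = ((2 powr (1 / p)) powr real l) powr p"
      by (simp only: powr_realpow[OF r_pos] r_def[symmetric])
    also have "\<dots> = 2 powr real l" using p by (simp add: powr_powr)
    finally show ?thesis by (simp add: powr_realpow)
  qed
  have X' [measurable]: "X (Suc i) \<in> borel_measurable M" for i
    by (rule X) simp
  interpret dominated_quasi_orthogonal M Z r "1 + 2 * C" h
  proof
    show "Z i \<in> borel_measurable M" for i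
      unfolding Z_def[abs_def] by measurable
    show "0 \<le> Z i \<omega>" for i \<omega> by (simp add: Z_def)
    show "0 < r" by (rule r_pos)
    have "r\<^sup>2 = 2 powr (2 / p)" by (simp add: r_def powr_power)
    moreover have "2 powr 1 < (2::real) powr (2 / p)" using p by (intro powr_less_mono) auto
    ultimately show "2 < r\<^sup>2" by simp
    have "2 powr (1 / p) \<le> (2::real) powr 1" using p by (intro powr_mono) auto
    then show "r \<le> 2" by (simp add: r_def)
    show "summable h"
      unfolding h_def
    proof (intro summable_mult summableI_nonneg_bounded)
      fix N
      \<comment> \<open>On nonnegative numbers, exceeding \<open>r ^ l\<close> means that the \<open>p\<close>-th power exceeds \<open>2 ^ l\<close>.\<close>
      have level: "prob {\<omega> \<in> space M. r ^ l < \<bar>Y \<omega>\<bar>}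
          = expectation (\<lambda>\<omega>. of_bool (2 ^ l < \<bar>Y \<omega>\<bar> powr p))" for l
      proof -
        have "r ^ l < y \<longleftrightarrow> 2 ^ l < y powr p" if "0 \<le> y" for y
          unfolding r_powr[symmetric]
          using that p r_pos powr_less_mono2[of p "r ^ l" y] powr_mono2[of p y "r ^ l"]
          by (cases "r ^ l < y") (simp_all add: not_less)
        then have "expectation (\<lambda>\<omega>. of_bool (2 ^ l < \<bar>Y \<omega>\<bar> powr p))
            = expectation (indicator {\<omega> \<in> space M. r ^ l < \<bar>Y \<omega>\<bar>})"
          by (intro Bochner_Integration.integral_cong) (auto simp: indicator_def)
        also have "\<dots> = prob ({\<omega> \<in> space M. r ^ l < \<bar>Y \<omega>\<bar>} \<inter> space M)"
          by (rule Bochner_Integration.integral_indicator)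
        also have "{\<omega> \<in> space M. r ^ l < \<bar>Y \<omega>\<bar>} \<inter> space M = {\<omega> \<in> space M. r ^ l < \<bar>Y \<omega>\<bar>}"
          by auto
        finally show ?thesis by simp
      qed
      have int: "integrable M (\<lambda>\<omega>. of_bool (2 ^ l < \<bar>Y \<omega>\<bar> powr p) :: real)" for l
        by (rule integrable_const_bound[where B = 1]) auto
      have "(\<Sum>l<N. 2 ^ l * prob {\<omega> \<in> space M. r ^ l < \<bar>Y \<omega>\<bar>})
          = expectation (\<lambda>\<omega>. \<Sum>l<N. 2 ^ l * of_bool (2 ^ l < \<bar>Y \<omega>\<bar> powr p))"
        unfolding level by (subst Bochner_Integration.integral_sum) (intro integrable_mult_right int, simp)
      also have "\<dots> \<le> expectation (\<lambda>\<omega>. 2 * \<bar>Y \<omega>\<bar> powr p)"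
      proof (intro integral_mono Bochner_Integration.integrable_sum integrable_mult_right int Y_p)
        fix \<omega>
        show "(\<Sum>l<N. 2 ^ l * of_bool (2 ^ l < \<bar>Y \<omega>\<bar> powr p)) \<le> 2 * \<bar>Y \<omega>\<bar> powr p"
          using sum_dyadic_below_le[of "\<bar>Y \<omega>\<bar> powr p" N] by (simp del: sum_mult_of_bool_eq)
      qed
      finally show "(\<Sum>l<N. 2 ^ l * prob {\<omega> \<in> space M. r ^ l < \<bar>Y \<omega>\<bar>}) \<le> expectation (\<lambda>\<omega>. 2 * \<bar>Y \<omega>\<bar> powr p)" .
    qed simp
    show "prob {\<omega> \<in> space M. r ^ l < Z i \<omega>} \<le> h l / 2 ^ l" for i l
    proof -
      have rl: "0 < r ^ l" using r_pos by simp
      have "prob {\<omega> \<in> space M. r ^ l < Z i \<omega>} \<le> prob {\<omega> \<in> space M. r ^ l < \<bar>X (Suc i) \<omega>\<bar>}"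
        using rl \<epsilon> by (intro finite_measure_mono) (auto simp: Z_def)
      also have "\<dots> \<le> D * prob {\<omega> \<in> space M. r ^ l < \<bar>Y \<omega>\<bar>}"
        by (rule D(2)) (use rl in auto)
      finally show ?thesis by (simp add: h_def)
    qed
    show "0 \<le> 1 + 2 * C" using C by simp
    show "expectation (\<lambda>\<omega>. (\<Sum>i=a..<a + n. min (Z i \<omega>) c - expectation (\<lambda>x. min (Z i x) c))\<^sup>2)
        \<le> (1 + 2 * C) * (\<Sum>i=a..<a + n. expectation (\<lambda>\<omega>. (min (Z i \<omega>) c)\<^sup>2))"
      if c: "0 \<le> c" for c a n
    proof (cases "n = 0")
      case False
      define \<phi> where "\<phi> y = \<epsilon> * min (max (\<epsilon> * y) 0) c" for y
      have \<phi>_mono: "mono \<phi>" using \<epsilon> by (auto intro!: monoI simp: \<phi>_def)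
      have \<phi>_bound: "\<bar>\<phi> y\<bar> \<le> c" for y using \<epsilon> c by (auto simp: \<phi>_def)
      have \<phi>_meas [measurable]: "\<phi> \<in> borel_measurable borel"
        unfolding \<phi>_def[abs_def] by measurable
      have \<phi>_Z: "\<phi> (X (Suc i) \<omega>) = \<epsilon> * min (Z i \<omega>) c" for i \<omega>
        by (simp add: \<phi>_def Z_def)
      have \<phi>X_meas: "(\<lambda>\<omega>. \<phi> (X i \<omega>)) \<in> borel_measurable M" if "1 \<le> i" for i
        using X[OF that] by measurable
      have \<epsilon>_sq: "(\<epsilon> * y)\<^sup>2 = y\<^sup>2" for y using \<epsilon> by (auto simp: power_mult_distrib)
      have sq_int: "integrable M (\<lambda>\<omega>. (\<phi> (X k \<omega>))\<^sup>2)" if "1 \<le> k" for k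
      proof (rule integrable_const_bound[where B = "c\<^sup>2"])
        show "AE \<omega> in M. norm ((\<phi> (X k \<omega>))\<^sup>2) \<le> c\<^sup>2"
          using power_mono[OF \<phi>_bound abs_ge_zero, of _ 2] by simp
        show "(\<lambda>\<omega>. (\<phi> (X k \<omega>))\<^sup>2) \<in> borel_measurable M" using \<phi>X_meas[OF that] by measurable
      qed
      have "expectation (\<lambda>\<omega>. (\<Sum>i=Suc a..a + n. \<phi> (X i \<omega>) - expectation (\<lambda>x. \<phi> (X i x)))\<^sup>2)
          \<le> (1 + 2 * C) * (\<Sum>i=Suc a..a + n. expectation (\<lambda>\<omega>. (\<phi> (X i \<omega>))\<^sup>2))"
        by (rule centred_sum_second_moment_le[where B = c, OF _ _ cov])
           (use False in \<open>auto intro: \<phi>X_meas \<phi>_bound \<phi>_mono sq_int\<close>)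
      moreover have "{Suc a..a + n} = {Suc a..<Suc (a + n)}" by auto
      moreover have "(\<Sum>i=a..<a + n. \<epsilon> * min (Z i \<omega>) c - expectation (\<lambda>x. \<epsilon> * min (Z i x) c))
          = \<epsilon> * (\<Sum>i=a..<a + n. min (Z i \<omega>) c - expectation (\<lambda>x. min (Z i x) c))" for \<omega>
        by (simp add: sum_distrib_left right_diff_distrib)
      ultimately show ?thesis
        by (simp only: sum.shift_bounds_Suc_ivl \<phi>_Z \<epsilon>_sq)
    qed simp
  qed
  show "integrable M (\<lambda>\<omega>. max (\<epsilon> * X n \<omega>) 0)" if "1 \<le> n"
    using Z_integrable[of "n - 1"] that by (simp add: Z_def[abs_def])
  show "AE \<omega> in M. (\<lambda>n. (\<Sum>k=1..n. max (\<epsilon> * X k \<omega>) 0 - expectation (\<lambda>x. max (\<epsilon> * X k x) 0))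
      / real n powr (1 / p)) \<longlonglongrightarrow> 0"
    using AE_prefix_bound
  proof eventually_elim
    case (elim \<omega>)
    then obtain \<rho> where "\<rho> \<longlonglongrightarrow> 0"
      "\<forall>\<^sub>F k in sequentially. \<forall>n\<le>2 ^ k. \<bar>\<Sum>i<n. Z i \<omega> - expectation (Z i)\<bar> \<le> \<rho> k * (2 powr (1 / p)) ^ k"
      unfolding r_def by blast
    from tendsto_0_of_dyadic_bound[OF _ this] p
    have "(\<lambda>n. (\<Sum>i<n. Z i \<omega> - expectation (Z i)) / real n powr (1 / p)) \<longlonglongrightarrow> 0" by simp
    then show ?case
      by (simp add: sum.atLeast1_atMost_eq Z_def[abs_def])
  qed
qed

theorem corollary3:
  fixes M :: "'a measure" and X :: "nat \<Rightarrow> 'a \<Rightarrow> real" and Y :: "'a \<Rightarrow> real" and p C :: real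
  assumes "prob_space M"
    and "1 \<le> p" and "p < 2"
    and "\<And>n. n \<ge> 1 \<Longrightarrow> X n \<in> borel_measurable M"
    and "Y \<in> borel_measurable M"
    and "stochastically_dominated M X Y"
    and "integrable M (\<lambda>\<omega>. \<bar>Y \<omega>\<bar> powr p)"
    and "C > 0"
    and "\<And>(m::nat) (n::nat) (\<phi>::real \<Rightarrow> real).
      \<lbrakk>1 \<le> m; m \<le> n; mono \<phi>; \<And>k. k \<ge> 1 \<Longrightarrow> integrable M (\<lambda>\<omega>. (\<phi> (X k \<omega>))\<^sup>2)\<rbrakk> \<Longrightarrow>
      \<bar>\<Sum>(i, j)\<in>{(i, j). m \<le> i \<and> i < j \<and> j \<le> n}.
          covariance M (\<lambda>\<omega>. \<phi> (X i \<omega>)) (\<lambda>\<omega>. \<phi> (X j \<omega>))\<bar>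
        \<le> C * (\<Sum>j=m..n. \<integral>\<omega>. (\<phi> (X j \<omega>))\<^sup>2 \<partial>M)"
  shows "AE \<omega> in M.
    (\<lambda>n. 1 / real n powr (1 / p) * (\<Sum>k=1..n. X k \<omega> - (\<integral>x. X k x \<partial>M))) \<longlonglongrightarrow> 0"
proof -
  interpret prob_space M by fact
  obtain D where D: "0 < D" "\<And>t. 0 < t \<Longrightarrow>
      (SUP n\<in>{1..}. prob {\<omega> \<in> space M. t < \<bar>X n \<omega>\<bar>}) \<le> D * prob {\<omega> \<in> space M. t < \<bar>Y \<omega>\<bar>}"
    using assms(6) unfolding stochastically_dominated_def by blast
  have dom: "prob {\<omega> \<in> space M. t < \<bar>X n \<omega>\<bar>} \<le> D * prob {\<omega> \<in> space M. t < \<bar>Y \<omega>\<bar>}"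
    if "1 \<le> n" "0 < t" for n t
  proof -
    have "prob {\<omega> \<in> space M. t < \<bar>X n \<omega>\<bar>} \<le> (SUP n\<in>{1..}. prob {\<omega> \<in> space M. t < \<bar>X n \<omega>\<bar>})"
      using that by (intro cSUP_upper bdd_aboveI2[where M = 1]) auto
    also note D(2)[OF that(2)]
    finally show ?thesis .
  qed
  note law = one_sided_strong_law[where X = X and Y = Y and p = p and C = C and D = D,
      OF assms(2-5) D(1) dom assms(7-9)]
  have int_pos: "integrable M (\<lambda>\<omega>. max (1 * X n \<omega>) 0)"
    and int_neg: "integrable M (\<lambda>\<omega>. max (- 1 * X n \<omega>) 0)" if "1 \<le> n" for n
    by (rule law(1); use that in simp)+
  have mean: "expectation (X n)
      = expectation (\<lambda>\<omega>. max (1 * X n \<omega>) 0) - expectation (\<lambda>\<omega>. max (- 1 * X n \<omega>) 0)"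
    if "1 \<le> n" for n
  proof -
    have "expectation (X n) = expectation (\<lambda>\<omega>. max (1 * X n \<omega>) 0 - max (- 1 * X n \<omega>) 0)"
      by (intro Bochner_Integration.integral_cong) auto
    also have "\<dots> = expectation (\<lambda>\<omega>. max (1 * X n \<omega>) 0) - expectation (\<lambda>\<omega>. max (- 1 * X n \<omega>) 0)"
      by (rule Bochner_Integration.integral_diff[OF int_pos[OF that] int_neg[OF that]])
    finally show ?thesis .
  qed
  have "AE \<omega> in M. (\<lambda>n. (\<Sum>k=1..n. max (1 * X k \<omega>) 0 - expectation (\<lambda>x. max (1 * X k x) 0))
      / real n powr (1 / p)) \<longlonglongrightarrow> 0"
    by (rule law(2)) simp_all
  moreover have "AE \<omega> in M. (\<lambda>n. (\<Sum>k=1..n. max (- 1 * X k \<omega>) 0 - expectation (\<lambda>x. max (- 1 * X k x) 0))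
      / real n powr (1 / p)) \<longlonglongrightarrow> 0"
    by (rule law(2)) simp_all
  ultimately show ?thesis
  proof eventually_elim
    case (elim \<omega>)
    have "(\<Sum>k=1..n. X k \<omega> - expectation (X k))
      = (\<Sum>k=1..n. max (1 * X k \<omega>) 0 - expectation (\<lambda>x. max (1 * X k x) 0))
      - (\<Sum>k=1..n. max (- 1 * X k \<omega>) 0 - expectation (\<lambda>x. max (- 1 * X k x) 0))" for n
      unfolding sum_subtractf[symmetric] by (intro sum.cong refl) (auto simp: mean)
    then show ?case
      using tendsto_diff[OF elim] by (simp only: diff_divide_distrib[symmetric] diff_zero mult_1_left times_divide_eq_left)
  qed
qed

end
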